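(* Let $M\in\mathbb R^{n\times n}$ be sufficient, $Q\in\mathbb R^{n\times d}$, $q\in\mathbb R^n$, $S=\{Q\theta+q:\theta\in\mathbb R^d\}$, and $S^\epsilon=S+\boldsymbol\epsilon$. There exists $\delta>0$ such that $S^\epsilon$ lies in general position for every $\epsilon\in(0,\delta)$.
   Context: $\boldsymbol\epsilon=(\epsilon,\epsilon^2,\dots,\epsilon^n)^T$. Let $A=[\,I\;\;-M\,]\in\mathbb R^{n\times 2n}$, columns indexed by $\{1,\dots,2n\}$; $A_{\cdot J}$ is the submatrix of columns indexed by $J$. Complementary index: $\bar i=i+n$ if $i\le n$, $\bar i=i-n$ if $i>n$. A set $J$ is complementary if $i\in J\Rightarrow\bar i\notin J$. A complementary basis is a complementary set $B$ with $|B|=n$ and $A_{\cdot B}$ invertible. Complementary cone: $\mathcal C(J)=\{A_{\cdot J}\lambda:\lambda\ge0\}$. An affine subspace $T$ lies in general position if for every complementary basis $B$: $T\cap\mathcal C(B)\neq\emptyset$ implies $T\cap\operatorname{int}\mathcal C(B)\neq\emptyset$. $M$ is column sufficient if $[z_i(Mz)_i\le 0\ \forall i]\Rightarrow[z_i(Mz)_i=0\ \forall i]$; row sufficient if $M^T$ is column sufficient; sufficient if both. *)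

theory Defs
  imports "HOL-Analysis.Analysis"
begin

text \<open>Column indices of A = [I, -M]: Inl i is column i (1 <= i <= n), Inr i is column i+n.
  The complement of Inl i is Inr i and vice versa.\<close>

definition column_sufficient :: "real^'n^'n \<Rightarrow> bool" where
  "column_sufficient M \<longleftrightarrow>
     (\<forall>z::real^'n. (\<forall>i. z$i * (M *v z)$i \<le> 0) \<longrightarrow> (\<forall>i. z$i * (M *v z)$i = 0))"

definition row_sufficient :: "real^'n^'n \<Rightarrow> bool" where
  "row_sufficient M \<longleftrightarrow> column_sufficient (transpose M)"

definition sufficient :: "real^'n^'n \<Rightarrow> bool" where
  "sufficient M \<longleftrightarrow> column_sufficient M \<and> row_sufficient M"

definition Acol :: "real^'n^'n \<Rightarrow> 'n + 'n \<Rightarrow> real^'n" where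
  "Acol M k = (case k of Inl i \<Rightarrow> axis i 1 | Inr i \<Rightarrow> - column i M)"

definition cbar :: "'n + 'n \<Rightarrow> 'n + 'n" where
  "cbar k = (case k of Inl i \<Rightarrow> Inr i | Inr i \<Rightarrow> Inl i)"

definition complementary :: "('n + 'n) set \<Rightarrow> bool" where
  "complementary J \<longleftrightarrow> (\<forall>k\<in>J. cbar k \<notin> J)"

text \<open>Submatrix A_B for a complementary set B of size n: B contains exactly one of
  Inl j, Inr j for each j, and column j of the (reordered) submatrix is that column of A.
  Reordering columns does not affect invertibility.\<close>
definition Asub :: "real^'n^'n \<Rightarrow> ('n + 'n) set \<Rightarrow> real^'n^'n" where
  "Asub M B = (\<chi> r c. Acol M (if Inl c \<in> B then Inl c else Inr c) $ r)"

definition comp_basis :: "real^'n^'n \<Rightarrow> ('n + 'n) set \<Rightarrow> bool" where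
  "comp_basis M B \<longleftrightarrow> complementary B \<and> card B = CARD('n) \<and> invertible (Asub M B)"

definition comp_cone :: "real^'n^'n \<Rightarrow> ('n + 'n) set \<Rightarrow> (real^'n) set" where
  "comp_cone M J = {(\<Sum>j\<in>J. l j *\<^sub>R Acol M j) | l. \<forall>j\<in>J. l j \<ge> 0}"

definition general_position :: "real^'n^'n \<Rightarrow> (real^'n) set \<Rightarrow> bool" where
  "general_position M T \<longleftrightarrow>
     (\<forall>B. comp_basis M B \<longrightarrow> T \<inter> comp_cone M B \<noteq> {} \<longrightarrow> T \<inter> interior (comp_cone M B) \<noteq> {})"

text \<open>The vector (eps, eps^2, ..., eps^n), indices ordered by the wellorder on 'n.\<close>
definition eps_vec :: "real \<Rightarrow> real^'n::{finite,wellorder}" where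
  "eps_vec e = (\<chi> i. e ^ (card {j. j < i} + 1))"

end

theory Submission
  imports Defs "HOL-Computational_Algebra.Polynomial"
begin

(* Write H_B for the inverse of the basis matrix A_B.  Then the complementary cone C(B) is
   {x. H_B x >= 0}, and {x. H_B x > 0} is an open subset of it.  Hence S + eps can violate
   general position at B only if the affine set H_B (S + eps) = range (H_B Q) + H_B (q + eps)
   meets the nonnegative orthant but misses the open orthant.

   For a fixed subspace V we show that the translates h + V with this "boundary only"
   behaviour are covered by finitely many hyperplanes {h. y . h = 0}, y <> 0: a Gordan-type
   separation argument yields a nonzero nonnegative y orthogonal to V with y . h = 0, and y may
   be taken of minimal support; a minimal support determines y up to a scalar, so finitely
   many y suffice.  Since eps_vec e = (e, e^2, ..., e^n), the value y . H_B (q + eps_vec e)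
   is a nonzero polynomial in e, so only finitely many e are bad for each of the finitely many
   bases.  Choosing delta below every positive bad value proves the theorem.

   The argument works for every square matrix M. *)

(* The exponent of eps in eps_vec is one plus the rank of the index, which is strictly monotone. *)
lemma card_less_strict_mono: "strict_mono (\<lambda>i::'n::{finite,wellorder}. card {j. j < i})"
proof (rule strict_monoI)
  fix x y :: 'n
  assume "x < y"
  then have "{j. j < x} \<subset> {j. j < y}" by auto
  then show "card {j. j < x} < card {j. j < y}" by (simp add: psubset_card_mono)
qed

(* c0 + c . eps_vec e is a nonzero polynomial in e when c <> 0, so it has finitely many roots. *)
lemma eps_vec_hyperplane_finite:
  fixes c :: "real^'n::{finite,wellorder}"
  assumes "c \<noteq> 0"
  shows "finite {e. c0 + inner c (eps_vec e) = 0}"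
proof -
  define r where "r i = card {j. j < i} + 1" for i :: 'n
  have "inj r"
    using strict_mono_imp_inj_on[OF card_less_strict_mono, of UNIV] unfolding r_def inj_on_def by simp
  define p where "p = [:c0:] + (\<Sum>i\<in>UNIV. monom (c$i) (r i))"
  have eval: "poly p e = c0 + inner c (eps_vec e)" for e
    by (simp add: p_def poly_sum poly_monom inner_vec_def eps_vec_def r_def mult.commute)
  obtain i0 where i0: "c$i0 \<noteq> 0" using assms by (metis vec_eq_iff zero_index)
  have "r i0 \<noteq> 0" by (simp add: r_def)
  then have "coeff p (r i0) = (\<Sum>i\<in>UNIV. if r i = r i0 then c$i else 0)"
    by (simp add: p_def coeff_sum coeff_pCons split: nat.split)
  also have "\<dots> = (\<Sum>i\<in>UNIV. if i = i0 then c$i else 0)"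
    using \<open>inj r\<close> by (simp add: inj_eq)
  finally have "coeff p (r i0) \<noteq> 0" using i0 by simp
  then have "p \<noteq> 0" by auto
  then have "finite {x. poly p x = 0}" by (rule poly_roots_finite)
  then show ?thesis using eval by simp
qed

(* A real number below every positive multiple of a fixed d is nonpositive. *)
lemma le_zero_if_below_all_multiples:
  fixes x d :: real
  assumes "\<And>s. 0 < s \<Longrightarrow> x \<le> s * d"
  shows "x \<le> 0"
proof (rule field_le_epsilon)
  fix e :: real
  assume "0 < e"
  define s where "s = e / (\<bar>d\<bar> + 1)"
  have "0 < s" using \<open>0 < e\<close> by (simp add: s_def)
  have "x \<le> s * d" using assms[OF \<open>0 < s\<close>] .
  also have "\<dots> \<le> s * (\<bar>d\<bar> + 1)" using \<open>0 < s\<close> by (intro mult_left_mono) auto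
  also have "\<dots> = e" by (simp add: s_def)
  finally show "x \<le> 0 + e" by simp
qed

(* A linear functional bounded below by b on the open orthant has nonnegative coefficients,
   and b <= 0 (the orthant is a cone accumulating at 0). *)
lemma open_orthant_lower_bound:
  fixes a :: "real^'n"
  assumes bound: "\<And>x. (\<forall>i. 0 < x$i) \<Longrightarrow> b \<le> inner a x"
  shows "b \<le> 0" and "0 \<le> a$i"
proof -
  define one :: "real^'n" where "one = (\<chi> j. 1)"
  have scaled: "b \<le> t * inner a x" if "\<forall>i. 0 < x$i" "0 < t" for x t
    using bound[of "t *\<^sub>R x"] that by simp
  show "b \<le> 0"
    by (rule le_zero_if_below_all_multiples[of b "inner a one"]) (simp add: scaled one_def)
  have "0 \<le> a$i + s * inner a one" if "0 < s" for s
  proof (rule ccontr)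
    assume neg: "\<not> 0 \<le> a$i + s * inner a one"
    have pos: "\<forall>j. 0 < (axis i 1 + s *\<^sub>R one)$j"
      using \<open>0 < s\<close> by (simp add: one_def axis_def)
    define t where "t = (\<bar>b\<bar> + 1) / - (a$i + s * inner a one)"
    have "0 < t" using neg by (simp add: t_def)
    have "b \<le> t * (a$i + s * inner a one)"
      using scaled[OF pos \<open>0 < t\<close>] by (simp add: inner_add_right inner_axis)
    also have "\<dots> = - (\<bar>b\<bar> + 1)" using neg by (simp add: t_def field_simps)
    finally show False by simp
  qed
  then show "0 \<le> a$i"
    using le_zero_if_below_all_multiples[of "- a$i" "inner a one"] by force
qed

(* A linear functional bounded above on a subspace vanishes there. *)
lemma linear_functional_bounded_on_subspace:
  assumes V: "subspace V" and bound: "\<And>v. v \<in> V \<Longrightarrow> inner a v \<le> c" and "v \<in> V"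
  shows "inner a v = 0"
proof (rule ccontr)
  assume nz: "inner a v \<noteq> 0"
  define t where "t = (c + 1) / inner a v"
  have "inner a (t *\<^sub>R v) \<le> c" using bound subspace_scale[OF V \<open>v \<in> V\<close>] by blast
  moreover have "inner a (t *\<^sub>R v) = c + 1" using nz by (simp add: t_def)
  ultimately show False by simp
qed

(* The translate h + V meets the closed nonnegative orthant but not the open positive orthant. *)
definition boundary_only_feasible :: "(real^'n) set \<Rightarrow> real^'n \<Rightarrow> bool" where
  "boundary_only_feasible V h \<longleftrightarrow>
     (\<exists>v\<in>V. \<forall>i. 0 \<le> (v + h)$i) \<and> \<not> (\<exists>v\<in>V. \<forall>i. 0 < (v + h)$i)"

(* y is a nonzero, componentwise nonnegative element of L. *)
definition semipositive :: "(real^'n) set \<Rightarrow> real^'n \<Rightarrow> bool" where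
  "semipositive L y \<longleftrightarrow> y \<in> L \<and> (\<forall>i. 0 \<le> y$i) \<and> y \<noteq> 0"

(* The open positive orthant is an intersection of open halfspaces. *)
lemma convex_open_orthant: "convex {x::real^'n. \<forall>i. 0 < x$i}"
proof -
  have "{x::real^'n. \<forall>i. 0 < x$i} = (\<Inter>i. {x. inner (axis i 1) x > 0})"
    by (auto simp: inner_axis')
  then show ?thesis by (simp add: convex_INT convex_halfspace_gt)
qed

(* Gordan-type alternative: if h + V touches the orthant only on its boundary, some nonzero
   nonnegative y orthogonal to V satisfies y . h = 0.  Proof by separating h + V from the
   open orthant. *)
lemma gordan_alternative:
  fixes h :: "real^'n"
  assumes V: "subspace V" and boundary: "boundary_only_feasible V h"
  shows "\<exists>y. semipositive (orthogonal_comp V) y \<and> inner y h = 0"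
proof -
  define S where "S = (+) h ` V"
  define T where "T = {x::real^'n. \<forall>i. 0 < x$i}"
  have "convex S" unfolding S_def by (rule convex_translation[OF subspace_imp_convex[OF V]])
  moreover have "convex T" unfolding T_def by (rule convex_open_orthant)
  moreover have "S \<noteq> {}" using subspace_0[OF V] by (auto simp: S_def)
  moreover have "(\<chi> j. 1) \<in> T" by (simp add: T_def)
  moreover have "S \<inter> T = {}" using boundary by (auto simp: boundary_only_feasible_def S_def T_def add.commute)
  ultimately obtain a b where "a \<noteq> 0" and below: "\<forall>x\<in>S. inner a x \<le> b" and above: "\<forall>x\<in>T. b \<le> inner a x"
    using separating_hyperplane_sets[of S T] by blast
  have orth: "inner a v = 0" if "v \<in> V" for v
  proof (rule linear_functional_bounded_on_subspace[OF V _ that])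
    fix w
    assume "w \<in> V"
    then show "inner a w \<le> b - inner a h" using below by (auto simp: S_def inner_add_right)
  qed
  have "b \<le> 0" and a_nonneg: "\<forall>i. 0 \<le> a$i"
    using open_orthant_lower_bound[of b a] above by (auto simp: T_def)
  obtain v0 where "v0 \<in> V" and feasible: "\<forall>i. 0 \<le> (v0 + h)$i"
    using boundary by (auto simp: boundary_only_feasible_def)
  have "0 \<le> inner a (v0 + h)" using a_nonneg feasible by (simp add: inner_vec_def sum_nonneg)
  moreover have "inner a (v0 + h) = inner a h" using orth[OF \<open>v0 \<in> V\<close>] by (simp add: inner_add_right)
  moreover have "inner a h \<le> b" using below subspace_0[OF V] by (auto simp: S_def)
  ultimately have "inner a h = 0" using \<open>b \<le> 0\<close> by linarith
  moreover have "a \<in> orthogonal_comp V" using orth by (simp add: orthogonal_comp_def orthogonal_def inner_commute)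
  ultimately show ?thesis using \<open>a \<noteq> 0\<close> a_nonneg by (auto simp: semipositive_def)
qed

(* The support of a vector: the set of its nonzero coordinates. *)
definition support_vec :: "real^'n \<Rightarrow> 'n set" where
  "support_vec y = {i. y$i \<noteq> 0}"

(* Semipositive elements of L whose support is minimal among all semipositive elements. *)
definition minimal_semipositive :: "(real^'n) set \<Rightarrow> real^'n \<Rightarrow> bool" where
  "minimal_semipositive L y \<longleftrightarrow>
     semipositive L y \<and> \<not> (\<exists>z. semipositive L z \<and> support_vec z \<subset> support_vec y)"

(* Subtracting the largest admissible multiple of z from y >= 0 keeps nonnegativity and
   kills at least one coordinate of the support of y. *)
lemma support_reduction:
  fixes y z :: "real^'n"
  assumes y_nonneg: "\<forall>i. 0 \<le> y$i" and sub: "support_vec z \<subseteq> support_vec y" and "0 < z$k"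
  obtains t where "0 < t" "\<forall>i. 0 \<le> (y - t *\<^sub>R z)$i" "support_vec (y - t *\<^sub>R z) \<subset> support_vec y"
proof -
  define K where "K = {i. 0 < z$i}"
  have "finite K" "K \<noteq> {}" using \<open>0 < z$k\<close> by (auto simp: K_def)
  define t where "t = Min ((\<lambda>i. y$i / z$i) ` K)"
  have "t \<in> (\<lambda>i. y$i / z$i) ` K"
    unfolding t_def using \<open>finite K\<close> \<open>K \<noteq> {}\<close> by (intro Min_in) auto
  then obtain i0 where "i0 \<in> K" and t_i0: "t = y$i0 / z$i0" by blast
  have t_le: "t \<le> y$i / z$i" if "i \<in> K" for i
    using that \<open>finite K\<close> by (simp add: t_def)
  have "z$i0 > 0" using \<open>i0 \<in> K\<close> by (simp add: K_def)
  moreover have "y$i0 \<noteq> 0" using \<open>z$i0 > 0\<close> sub by (force simp: support_vec_def)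
  ultimately have "y$i0 > 0" using y_nonneg by (simp add: order_less_le)
  then have "0 < t" using \<open>z$i0 > 0\<close> t_i0 by simp
  have "0 \<le> (y - t *\<^sub>R z)$i" for i
  proof (cases "i \<in> K")
    case True
    then have "t * z$i \<le> y$i" using t_le[OF True] by (simp add: K_def pos_le_divide_eq)
    then show ?thesis by simp
  next
    case False
    then have "t * z$i \<le> 0" using \<open>0 < t\<close> by (simp add: K_def mult_nonneg_nonpos)
    then show ?thesis using y_nonneg[rule_format, of i] by simp
  qed
  moreover have "support_vec (y - t *\<^sub>R z) \<subset> support_vec y"
  proof -
    have "support_vec (y - t *\<^sub>R z) \<subseteq> support_vec y" using sub by (auto simp: support_vec_def)
    moreover have "(y - t *\<^sub>R z)$i0 = 0" using t_i0 \<open>z$i0 > 0\<close> by simp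
    ultimately show ?thesis using \<open>y$i0 > 0\<close> by (auto simp: support_vec_def)
  qed
  ultimately show ?thesis using that \<open>0 < t\<close> by blast
qed

(* A minimal semipositive y spans every element of L supported inside its support; in
   particular a minimal support determines the vector up to a scalar factor. *)
lemma minimal_semipositive_unique:
  assumes L: "subspace L" and y: "minimal_semipositive L y"
    and "u \<in> L" and u_sub: "support_vec u \<subseteq> support_vec y"
  shows "\<exists>c. u = c *\<^sub>R y"
proof -
  have y_nonneg: "\<forall>i. 0 \<le> y$i" using y by (simp add: minimal_semipositive_def semipositive_def)
  have ray: "\<exists>c. w = c *\<^sub>R y"
    if "w \<in> L" and w_sub: "support_vec w \<subseteq> support_vec y" and w_pos: "0 < w$k" for w k
  proof -
    obtain t where "0 < t" and nonneg: "\<forall>i. 0 \<le> (y - t *\<^sub>R w)$i"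
      and smaller: "support_vec (y - t *\<^sub>R w) \<subset> support_vec y"
      by (rule support_reduction[OF y_nonneg w_sub w_pos])
    have "y \<in> L" using y by (simp add: minimal_semipositive_def semipositive_def)
    then have "y - t *\<^sub>R w \<in> L" using L \<open>w \<in> L\<close> by (simp add: subspace_diff subspace_scale)
    then have "y - t *\<^sub>R w = 0"
      using y nonneg smaller by (auto simp: minimal_semipositive_def semipositive_def)
    then have "w = (1 / t) *\<^sub>R y" using \<open>0 < t\<close> by (simp add: field_simps)
    then show ?thesis by blast
  qed
  show ?thesis
  proof (cases "u = 0")
    case True
    then show ?thesis by (metis scale_zero_left)
  next
    case False
    then obtain k where "u$k \<noteq> 0" by (metis vec_eq_iff zero_index)
    show ?thesis
    proof (cases "0 < u$k")
      case True
      then show ?thesis using ray[OF \<open>u \<in> L\<close> u_sub] by blast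
    next
      case False
      then have "0 < (- u)$k" using \<open>u$k \<noteq> 0\<close> by simp
      moreover have "- u \<in> L" using L \<open>u \<in> L\<close> by (simp add: subspace_neg)
      moreover have "support_vec (- u) = support_vec u" by (simp add: support_vec_def)
      ultimately obtain c where "- u = c *\<^sub>R y" using ray[of "- u" k] u_sub by auto
      then have "u = (- c) *\<^sub>R y" by (metis minus_minus scaleR_minus_left)
      then show ?thesis by blast
    qed
  qed
qed

(* If y0 . h = 0 for some semipositive y0 while z . h >= 0 for all semipositive z, then
   already a minimal semipositive vector is orthogonal to h. *)
lemma exists_minimal_semipositive:
  assumes L: "subspace L" and "semipositive L y0" "inner y0 h = 0"
    and h_nonneg: "\<And>z. semipositive L z \<Longrightarrow> 0 \<le> inner z h"
  shows "\<exists>y. minimal_semipositive L y \<and> inner y h = 0"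
proof -
  obtain y where y: "semipositive L y" "inner y h = 0"
    and least: "\<And>z. semipositive L z \<Longrightarrow> inner z h = 0 \<Longrightarrow> card (support_vec y) \<le> card (support_vec z)"
    using ex_has_least_nat[of "\<lambda>y. semipositive L y \<and> inner y h = 0" y0 "\<lambda>y. card (support_vec y)"]
      assms(2,3) by blast
  have "minimal_semipositive L y"
    unfolding minimal_semipositive_def
  proof (intro conjI notI)
    show "semipositive L y" by (rule y(1))
    assume "\<exists>z. semipositive L z \<and> support_vec z \<subset> support_vec y"
    then obtain z where z: "semipositive L z" and z_sub: "support_vec z \<subset> support_vec y" by blast
    have "z \<noteq> 0" and y_nonneg: "\<forall>i. 0 \<le> y$i" using z y(1) by (simp_all add: semipositive_def)
    from \<open>z \<noteq> 0\<close> obtain k where "z$k \<noteq> 0" by (metis vec_eq_iff zero_index)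
    then have "0 < z$k" using z by (simp add: semipositive_def order_less_le)
    obtain t where "0 < t" and nonneg: "\<forall>i. 0 \<le> (y - t *\<^sub>R z)$i"
      and "support_vec (y - t *\<^sub>R z) \<subset> support_vec y"
      by (rule support_reduction[OF y_nonneg psubset_imp_subset[OF z_sub] \<open>0 < z$k\<close>])
    have "y - t *\<^sub>R z \<in> L"
      using L y(1) z by (simp add: semipositive_def subspace_diff subspace_scale)
    have "inner z h = 0"
    proof (cases "y - t *\<^sub>R z = 0")
      case True
      then have "t * inner z h = 0" using y(2) by (simp add: algebra_simps)
      then show ?thesis using \<open>0 < t\<close> by simp
    next
      case False
      then have "0 \<le> inner (y - t *\<^sub>R z) h"
        using h_nonneg nonneg \<open>y - t *\<^sub>R z \<in> L\<close> by (simp add: semipositive_def)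
      then have "t * inner z h \<le> 0" using y(2) by (simp add: inner_diff_left)
      then show ?thesis using h_nonneg[OF z] \<open>0 < t\<close> by (simp add: mult_le_0_iff)
    qed
    then have "card (support_vec y) \<le> card (support_vec z)" using least z by blast
    moreover have "card (support_vec z) < card (support_vec y)" using z_sub by (simp add: psubset_card_mono)
    ultimately show False by simp
  qed
  then show ?thesis using y(2) by blast
qed

(* Main finiteness fact: the translates h + V touching the orthant only on the boundary lie in
   finitely many hyperplanes through the origin (one per minimal support of V's orthogonal
   complement). *)
lemma finite_boundary_witnesses:
  assumes V: "subspace V"
  shows "\<exists>Y. finite Y \<and> 0 \<notin> Y \<and>
           (\<forall>h. boundary_only_feasible V h \<longrightarrow> (\<exists>y\<in>Y. inner y h = 0))"
proof -
  define L where "L = orthogonal_comp V"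
  have L: "subspace L" by (simp add: L_def subspace_orthogonal_comp)
  define rep where "rep S = (SOME y. minimal_semipositive L y \<and> support_vec y = S)" for S
  have rep: "minimal_semipositive L (rep (support_vec y)) \<and> support_vec (rep (support_vec y)) = support_vec y"
    if "minimal_semipositive L y" for y
    unfolding rep_def by (rule someI[where x = y]) (simp add: that)
  define Y where "Y = rep ` {S. \<exists>y. minimal_semipositive L y \<and> support_vec y = S}"
  have "finite Y" by (simp add: Y_def)
  moreover have "0 \<notin> Y"
    using rep by (auto simp: Y_def minimal_semipositive_def semipositive_def)
  moreover have "\<exists>y\<in>Y. inner y h = 0" if boundary: "boundary_only_feasible V h" for h
  proof -
    obtain y0 where "semipositive L y0" "inner y0 h = 0"
      using gordan_alternative[OF V boundary] by (auto simp: L_def)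
    obtain v0 where "v0 \<in> V" and feasible: "\<forall>i. 0 \<le> (v0 + h)$i"
      using boundary by (auto simp: boundary_only_feasible_def)
    have "0 \<le> inner z h" if "semipositive L z" for z
    proof -
      have "0 \<le> inner z (v0 + h)"
        using that feasible by (simp add: semipositive_def inner_vec_def sum_nonneg)
      moreover have "inner z v0 = 0"
        using that \<open>v0 \<in> V\<close> unfolding semipositive_def L_def orthogonal_comp_def orthogonal_def
        by (simp add: inner_commute)
      ultimately show ?thesis by (simp add: inner_add_right)
    qed
    then obtain y where y: "minimal_semipositive L y" "inner y h = 0"
      using exists_minimal_semipositive[OF L \<open>semipositive L y0\<close> \<open>inner y0 h = 0\<close>] by blast
    define r where "r = rep (support_vec y)"
    have r: "minimal_semipositive L r" "support_vec r = support_vec y" "r \<in> Y"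
      using rep[OF y(1)] y(1) by (auto simp: r_def Y_def)
    have "y \<in> L" and "y \<noteq> 0" using y(1) by (simp_all add: minimal_semipositive_def semipositive_def)
    then obtain c where c: "y = c *\<^sub>R r"
      using minimal_semipositive_unique[OF L r(1), of y] r(2) by auto
    then have "c \<noteq> 0" using \<open>y \<noteq> 0\<close> by auto
    moreover have "c * inner r h = 0" using y(2) c by simp
    ultimately show ?thesis using r(3) by auto
  qed
  ultimately show ?thesis by blast
qed

(* Along the curve e |-> g + H eps_vec e with H invertible, boundary-only translates occur
   for finitely many e only. *)
lemma finite_boundary_perturbations:
  fixes H :: "real^'n::{finite,wellorder}^'n::{finite,wellorder}"
  assumes V: "subspace V" and H: "invertible H"
  shows "finite {e. boundary_only_feasible V (g + H *v eps_vec e)}"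
proof -
  obtain Y where "finite Y" and "0 \<notin> Y"
    and witness: "\<And>h. boundary_only_feasible V h \<Longrightarrow> \<exists>y\<in>Y. inner y h = 0"
    using finite_boundary_witnesses[OF V] by blast
  obtain H' where HH': "H ** H' = mat 1" using H by (auto simp: invertible_def)
  have "finite {e. inner y g + inner (y v* H) (eps_vec e) = 0}" if "y \<in> Y" for y
  proof (rule eps_vec_hyperplane_finite)
    show "y v* H \<noteq> 0"
    proof
      assume "y v* H = 0"
      then have "(y v* H) v* H' = 0" by (simp add: vector_matrix_mult_def vec_eq_iff)
      then have "y = 0" by (simp add: vector_matrix_mul_assoc HH')
      then show False using \<open>y \<in> Y\<close> \<open>0 \<notin> Y\<close> by simp
    qed
  qed
  then have "finite (\<Union>y\<in>Y. {e. inner y g + inner (y v* H) (eps_vec e) = 0})"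
    using \<open>finite Y\<close> by blast
  moreover have "{e. boundary_only_feasible V (g + H *v eps_vec e)}
      \<subseteq> (\<Union>y\<in>Y. {e. inner y g + inner (y v* H) (eps_vec e) = 0})"
    using witness by (force simp: inner_add_right dot_lmul_matrix)
  ultimately show ?thesis by (rule finite_subset[rotated])
qed

(* The column of the complementary set B that sits in position c. *)
definition basis_column :: "('n + 'n) set \<Rightarrow> 'n \<Rightarrow> 'n + 'n" where
  "basis_column B c = (if Inl c \<in> B then Inl c else Inr c)"

(* A complementary set of size n picks exactly one of Inl c, Inr c for every position c. *)
lemma basis_column_bij:
  fixes B :: "('n::finite + 'n) set"
  assumes comp: "complementary B" and card: "card B = CARD('n)"
  shows "bij_betw (basis_column B) UNIV B"
proof -
  define position where "position = case_sum id (id :: 'n \<Rightarrow> 'n)"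
  have "inj_on position B"
  proof (rule inj_onI)
    fix j j' assume "j \<in> B" "j' \<in> B" "position j = position j'"
    then show "j = j'"
      using comp by (cases j; cases j') (auto simp: position_def complementary_def cbar_def)
  qed
  then have "card (position ` B) = CARD('n)" using card by (simp add: card_image)
  then have "position ` B = UNIV" by (simp add: card_subset_eq)
  have "basis_column B c \<in> B" for c
  proof -
    obtain j where "j \<in> B" and "position j = c" using \<open>position ` B = UNIV\<close> by (metis UNIV_I imageE)
    then show ?thesis by (cases j) (auto simp: position_def basis_column_def)
  qed
  then have "range (basis_column B) \<subseteq> B" by blast
  moreover have inj: "inj (basis_column B)" by (rule injI) (auto simp: basis_column_def split: if_splits)
  moreover have "card (range (basis_column B)) = card B" using card by (simp add: card_image[OF inj])
  ultimately have "range (basis_column B) = B" by (simp add: card_subset_eq)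
  then show ?thesis using inj by (simp add: bij_betw_def)
qed

(* The complementary cone of a complementary n-set is the image of the orthant under A_B. *)
lemma comp_cone_as_image:
  fixes B :: "('n::finite + 'n) set"
  assumes comp: "complementary B" and card: "card B = CARD('n)"
  shows "comp_cone M B = (\<lambda>w. Asub M B *v w) ` {w. \<forall>i. 0 \<le> w$i}"
proof -
  have bij: "bij_betw (basis_column B) UNIV B" by (rule basis_column_bij[OF comp card])
  have combination: "(\<Sum>j\<in>B. l j *\<^sub>R Acol M j) = Asub M B *v (\<chi> c. l (basis_column B c))" for l
  proof -
    have "(\<Sum>j\<in>B. l j *\<^sub>R Acol M j) = (\<Sum>c\<in>UNIV. l (basis_column B c) *\<^sub>R Acol M (basis_column B c))"
      using sum.reindex_bij_betw[OF bij, of "\<lambda>j. l j *\<^sub>R Acol M j"] by simp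
    also have "\<dots> = Asub M B *v (\<chi> c. l (basis_column B c))"
      by (simp add: matrix_mult_sum column_def Asub_def basis_column_def scalar_mult_eq_scaleR vec_eq_iff)
    finally show ?thesis .
  qed
  show ?thesis
  proof (intro equalityI subsetI)
    fix x assume "x \<in> comp_cone M B"
    then obtain l where "x = (\<Sum>j\<in>B. l j *\<^sub>R Acol M j)" and "\<forall>j\<in>B. 0 \<le> l j"
      by (auto simp: comp_cone_def)
    moreover have "basis_column B c \<in> B" for c using bij by (simp add: bij_betw_apply)
    ultimately show "x \<in> (\<lambda>w. Asub M B *v w) ` {w. \<forall>i. 0 \<le> w$i}"
      using combination by force
  next
    fix x assume "x \<in> (\<lambda>w. Asub M B *v w) ` {w. \<forall>i. 0 \<le> w$i}"
    then obtain w where x: "x = Asub M B *v w" and "\<forall>i. 0 \<le> w$i" by blast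
    define l where "l j = w $ case_sum id id j" for j
    have "(\<chi> c. l (basis_column B c)) = w" by (simp add: l_def basis_column_def vec_eq_iff)
    then have "x = (\<Sum>j\<in>B. l j *\<^sub>R Acol M j)" using x combination by simp
    moreover have "\<forall>j\<in>B. 0 \<le> l j" using \<open>\<forall>i. 0 \<le> w$i\<close> by (simp add: l_def)
    ultimately show "x \<in> comp_cone M B" by (auto simp: comp_cone_def)
  qed
qed

(* matrix_inv is a two-sided inverse of an invertible matrix. *)
lemma matrix_inv_both_sides:
  assumes "invertible (A::real^'n^'n)"
  shows "A ** matrix_inv A = mat 1" and "matrix_inv A ** A = mat 1"
  using someI_ex[OF assms[unfolded invertible_def]] by (simp_all add: matrix_inv_def)

(* For a complementary basis, C(B) is the preimage of the orthant under A_B^{-1}. *)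
lemma comp_cone_via_inverse:
  assumes "comp_basis M B"
  shows "comp_cone M B = {x. \<forall>i. 0 \<le> (matrix_inv (Asub M B) *v x)$i}"
proof -
  let ?A = "Asub M B" and ?H = "matrix_inv (Asub M B)"
  have "invertible ?A" using assms by (simp add: comp_basis_def)
  then have AH: "?A ** ?H = mat 1" and HA: "?H ** ?A = mat 1" by (rule matrix_inv_both_sides)+
  have left_inverse: "?H *v (?A *v w) = w" and right_inverse: "?A *v (?H *v w) = w" for w
    by (simp_all add: matrix_vector_mul_assoc AH HA)
  have "comp_cone M B = (\<lambda>w. ?A *v w) ` {w. \<forall>i. 0 \<le> w$i}"
    using assms by (simp add: comp_basis_def comp_cone_as_image)
  also have "\<dots> = {x. \<forall>i. 0 \<le> (?H *v x)$i}"
  proof (intro equalityI subsetI)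
    fix x assume "x \<in> (\<lambda>w. ?A *v w) ` {w. \<forall>i. 0 \<le> w$i}"
    then show "x \<in> {x. \<forall>i. 0 \<le> (?H *v x)$i}" by (auto simp: left_inverse)
  next
    fix x assume "x \<in> {x. \<forall>i. 0 \<le> (?H *v x)$i}"
    then show "x \<in> (\<lambda>w. ?A *v w) ` {w. \<forall>i. 0 \<le> w$i}"
      by (intro image_eqI[of x _ "?H *v x"]) (simp_all add: right_inverse)
  qed
  finally show ?thesis .
qed

(* The preimage of the open orthant under a linear map is open. *)
lemma open_positive_preimage:
  fixes H :: "real^'n^'m"
  shows "open {x. \<forall>i. 0 < (H *v x)$i}"
proof -
  have "{x. \<forall>i. 0 < (H *v x)$i} = (\<Inter>i. {x. 0 < (H *v x)$i})" by auto
  moreover have "open {x. 0 < (H *v x)$i}" for i by (intro open_Collect_less continuous_intros)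
  ultimately show ?thesis by auto
qed

(* General position of the affine set range Q + p follows once, for every complementary basis,
   its image under A_B^{-1} does not touch the orthant only on the boundary. *)
lemma general_position_of_nondegenerate:
  assumes nondeg: "\<And>B. comp_basis M B \<Longrightarrow>
      \<not> boundary_only_feasible (range ((*v) (matrix_inv (Asub M B) ** Q))) (matrix_inv (Asub M B) *v p)"
  shows "general_position M {Q *v \<theta> + p | \<theta>. True}"
  unfolding general_position_def
proof (intro allI impI)
  fix B
  assume basis: "comp_basis M B" and meets: "{Q *v \<theta> + p | \<theta>. True} \<inter> comp_cone M B \<noteq> {}"
  let ?H = "matrix_inv (Asub M B)"
  have image: "?H *v (Q *v \<theta> + p) = (?H ** Q) *v \<theta> + ?H *v p" for \<theta>
    by (simp add: matrix_vector_right_distrib matrix_vector_mul_assoc)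
  obtain \<theta>0 where "Q *v \<theta>0 + p \<in> comp_cone M B" using meets by blast
  then have "\<forall>i. 0 \<le> ((?H ** Q) *v \<theta>0 + ?H *v p)$i"
    by (simp add: comp_cone_via_inverse[OF basis] image)
  then have "\<exists>v\<in>range ((*v) (?H ** Q)). \<forall>i. 0 \<le> (v + ?H *v p)$i" by blast
  then obtain \<theta> where "\<forall>i. 0 < ((?H ** Q) *v \<theta> + ?H *v p)$i"
    using nondeg[OF basis] unfolding boundary_only_feasible_def by blast
  then have "Q *v \<theta> + p \<in> {x. \<forall>i. 0 < (?H *v x)$i}" by (simp add: image)
  moreover have "{x. \<forall>i. 0 < (?H *v x)$i} \<subseteq> interior (comp_cone M B)"
    by (rule interior_maximal[OF _ open_positive_preimage])
      (auto simp: comp_cone_via_inverse[OF basis] less_imp_le)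
  ultimately show "{Q *v \<theta> + p | \<theta>. True} \<inter> interior (comp_cone M B) \<noteq> {}" by blast
qed

(* A finite set of reals misses an interval (0, delta). *)
lemma finite_avoids_small_positive:
  fixes F :: "real set"
  assumes "finite F"
  shows "\<exists>\<delta>>0. \<forall>e. 0 < e \<and> e < \<delta> \<longrightarrow> e \<notin> F"
proof (intro exI conjI allI impI)
  let ?P = "insert 1 {e\<in>F. 0 < e}"
  have "finite ?P" using assms by simp
  then show "0 < Min ?P" by (subst Min_gr_iff) auto
  show "e \<notin> F" if "0 < e \<and> e < Min ?P" for e
    using that Min_le[OF \<open>finite ?P\<close>, of e] by auto
qed

(* The bad perturbation sizes form a finite union, over complementary bases, of finite sets. *)
theorem mainTheorem10:
  fixes M :: "real^'n::{finite,wellorder}^'n::{finite,wellorder}"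
    and Q :: "real^'d::finite^'n::{finite,wellorder}"
    and q :: "real^'n::{finite,wellorder}"
  assumes "sufficient M"
  shows "\<exists>\<delta>>0. \<forall>\<epsilon>. 0 < \<epsilon> \<and> \<epsilon> < \<delta> \<longrightarrow>
           general_position M {Q *v \<theta> + q + eps_vec \<epsilon> | \<theta>. True}"
proof -
  define H where "H B = matrix_inv (Asub M B)" for B
  define bad where
    "bad B = {e. boundary_only_feasible (range ((*v) (H B ** Q))) (H B *v q + H B *v eps_vec e)}"
    for B
  have "finite (bad B)" if "comp_basis M B" for B
  proof -
    have "invertible (H B)"
      using that matrix_inv_both_sides[of "Asub M B"] by (auto simp: H_def comp_basis_def invertible_def)
    then show ?thesis
      unfolding bad_def by (intro finite_boundary_perturbations) (simp_all add: linear_subspace_image)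
  qed
  then have "finite (\<Union>B\<in>{B. comp_basis M B}. bad B)" by simp
  then obtain \<delta> where "0 < \<delta>"
    and good: "\<And>e. 0 < e \<and> e < \<delta> \<Longrightarrow> e \<notin> (\<Union>B\<in>{B. comp_basis M B}. bad B)"
    using finite_avoids_small_positive by blast
  have "general_position M {Q *v \<theta> + (q + eps_vec \<epsilon>) | \<theta>. True}" if "0 < \<epsilon> \<and> \<epsilon> < \<delta>" for \<epsilon>
    by (rule general_position_of_nondegenerate)
      (use good[OF that] in \<open>auto simp: bad_def H_def matrix_vector_right_distrib\<close>)
  then show ?thesis using \<open>0 < \<delta>\<close> by (auto simp: add.assoc)
qed

end
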